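(* For every sufficiently small $t>0$, the partial fiber product \[ F_{1/3,t}=A_{1/3}\times_{P_1}C_{3,t}^{\mathrm{reg}}\longrightarrow P_2^-\times P_3 \] has three distinct transverse points whose images in $P_2^*\times P_3^*$ are all \[ \bigl((0,\pi/2),(0,\pi/2)\bigr). \] Consequently, $F_{1/3,t}\to P_2^-\times P_3$ is not embedded.
   Context: **Pillowcases.** $\mathrm{SU}(2)$ is the group of unit quaternions; traceless elements are purely imaginary units. The traceless $\mathrm{SU}(2)$ character variety of a four-punctured sphere is the pillowcase $P=(\mathbb{R}/2\pi\mathbb{Z})^2/((\gamma,\theta)\sim(-\gamma,-\theta))$, with symplectic form $d\gamma\wedge d\theta$ on its smooth locus $P^*$ (the complement of the four corners $\{0,\pi\}^2$). $P^-$ denotes $P$ with the sign of the form reversed. **Smith's correspondence.** $C_3$ is Smith's three-boundary-sphere configuration, whose first two boundary spheres are filled by tangles $T_1,T_2$ to produce the Conway sum $T_1+T_2$ with boundary the third sphere; $P_1,P_2,P_3$ are the pillowcases of the three boundary spheres, and $p_1,p_2,p_3$ the boundary restriction maps. $\mathcal{R}_{D_t}(C_3)$ is Smith's holonomy-perturbed traceless $\mathrm{SU}(2)$ character variety of $C_3$ with perturbation parameter $t$; $C_{3,t}^{\mathrm{reg}}\looparrowright P_1^-\times P_2^-\times P_3$ is its regular Lagrangian locus, namely the part whose boundary restriction lies in $P_1^*\times P_2^*\times P_3^*$. At $t=0$, on the main stratum, $p_1=(\gamma,\beta)$, $p_2=(\gamma,\theta-\beta)$, $p_3=(\gamma,\theta)$.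 $A_{1/3}\looparrowright P_1$ is the rational line of slope $1/3$, the character variety of the rational tangle $Q_{1/3}$; in torus coordinates of $P_1$ its equation is $3\theta_1-\gamma_1\in2\pi\mathbb{Z}$. The fiber product $F_{1/3,t}$ is mapped to $P_2^-\times P_3$ by $(p_2,p_3)$; a point of it is transverse if the fiber product is transverse there. **Local form of the parametrization.** In Smith's parametrization the third boundary data are $(a,b,c,d)$; over $\gamma=0$, $\theta=\pi/2$ one has $a=b=\mathbf{i}$, $c=d=\mathbf{j}$, and $p_3=(0,\pi/2)$. There is a further imaginary unit quaternion $x$, parametrized by angles $(\alpha,\beta)$, and a perturbation element $p$ depending on $t$; the defining equation is $\operatorname{Re}(y)=0$ with $y=xp^{-1}a^{-1}pb$. Writing $v(\varphi)=\cos\varphi\,\mathbf{i}+\sin\varphi\,\mathbf{k}$, for $\beta\in\{0,\pi\}$ one has $x=v(\varphi)$ and $p=e^{-u\mathbf{j}}$, where $(\varphi,u)=(\pi/2-\alpha,\,t\sin\alpha)$ if $\beta=0$ and $(\varphi,u)=(\pi/2+\alpha,\,-t\sin\alpha)$ if $\beta=\pi$. There the first boundary value has torus coordinates $(\gamma_1,\theta_1)=(2u,\varphi+2u)$, and the second boundary words are $(v(\varphi+2u),v(\varphi+2u),\mathbf{j},\mathbf{j})$. *)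

theory Defs
  imports "HOL-Analysis.Analysis"
begin

section \<open>Quaternions and \<open>SU(2)\<close>\<close>

text \<open>
  The pair \<open>(z, w)\<close> of complex numbers stands for the quaternion \<open>z + w j\<close>, where
  \<open>j z = cnj z j\<close>; thus \<open>k = i j\<close> is \<open>(\<i>, 0) (0, 1) = (0, \<i>)\<close>.  The norm and the topology of the
  product type are those of Euclidean 4-space.
\<close>

type_synonym quat = "complex \<times> complex"

definition qmult :: "quat \<Rightarrow> quat \<Rightarrow> quat"  (infixl \<open>\<odot>\<close> 70)
  where "p \<odot> q = (fst p * fst q - snd p * cnj (snd q), fst p * snd q + snd p * cnj (fst q))"

definition qone :: quat where "qone = (1, 0)"
definition qi :: quat where "qi = (\<i>, 0)"
definition qj :: quat where "qj = (0, 1)"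
definition qk :: quat where "qk = (0, \<i>)"

definition qRe :: "quat \<Rightarrow> real" where "qRe q = Re (fst q)"
definition qIm :: "quat \<Rightarrow> quat" where "qIm q = q - qRe q *\<^sub>R qone"

text \<open>Quaternionic conjugation; on unit quaternions this is the inverse.\<close>

definition qcnj :: "quat \<Rightarrow> quat" where "qcnj q = (cnj (fst q), - snd q)"

definition qexp :: "quat \<Rightarrow> quat" where
  "qexp q = exp (qRe q) *\<^sub>R
     (cos (norm (qIm q)) *\<^sub>R qone + (sin (norm (qIm q)) / norm (qIm q)) *\<^sub>R qIm q)"

definition SU2 :: "quat set" where "SU2 = {q. norm q = 1}"

definition traceless :: "quat set" where "traceless = {q \<in> SU2. qRe q = 0}"

definition qconj :: "quat \<Rightarrow> quat \<Rightarrow> quat" where "qconj g q = g \<odot> q \<odot> qcnj g"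

lemma quat_parts [simp]:
  "qRe (z, w) = Re z" "qcnj (z, w) = (cnj z, - w)"
  "(z, w) \<odot> (z', w') = (z * z' - w * cnj w', z * w' + w * cnj z')"
  "qIm (z, w) = (\<i> * Im z, w)"
  by (simp_all add: qRe_def qcnj_def qmult_def qIm_def qone_def complex_eq_iff)

lemma sin_abs_div: "(sin \<bar>u\<bar> / \<bar>u\<bar>) * u = sin (u::real)"
  by (cases "u = 0"; cases "u > 0") (auto simp: abs_if)

lemma qexp_k: "qexp (u *\<^sub>R qk) = (complex_of_real (cos u), \<i> * complex_of_real (sin u))"
  using sin_abs_div[of u] by (auto simp: qexp_def qk_def qone_def norm_Pair norm_mult complex_eq_iff)

lemma qexp_j: "qexp (u *\<^sub>R qj) = (complex_of_real (cos u), complex_of_real (sin u))"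
  using sin_abs_div[of u] by (auto simp: qexp_def qj_def qone_def norm_Pair norm_mult complex_eq_iff)

lemma qexp_k_i: "qexp (u *\<^sub>R qk) \<odot> qi = (\<i> * complex_of_real (cos u), complex_of_real (sin u))"
  by (simp add: qexp_k qi_def complex_eq_iff)


section \<open>The pillowcase\<close>

text \<open>
  A point of the pillowcase is the set of all its lifts to the plane, i.e. an equivalence class of
  \<open>(\<gamma>, \<theta>) \<sim> (-\<gamma>, -\<theta>)\<close> modulo \<open>2\<pi>\<close> in each coordinate.
\<close>

type_synonym pillow_point = "(real \<times> real) set"

definition pillow :: "real \<times> real \<Rightarrow> pillow_point" where
  "pillow = (\<lambda>(\<gamma>, \<theta>). {(\<epsilon> * \<gamma> + 2 * pi * of_int m, \<epsilon> * \<theta> + 2 * pi * of_int n) | \<epsilon> m n.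
      \<epsilon> \<in> {1, -1::real}})"

definition pillow_corners :: "pillow_point set" where
  "pillow_corners = pillow ` ({0, pi} \<times> {0, pi})"

definition pillow_smooth :: "pillow_point set" where
  "pillow_smooth = range pillow - pillow_corners"

text \<open>
  A traceless representation of the four-punctured sphere is a quadruple \<open>(A, B, C, D)\<close> of traceless
  elements with \<open>D = C A\<^sup>-\<^sup>1 B\<close>.  Its point in the pillowcase is that \<open>(\<gamma>, \<theta>)\<close> for which it
  is conjugate to \<open>(i, e\<^sup>\<gamma>\<^sup>k i, e\<^sup>\<theta>\<^sup>k i, e\<^sup>(\<^sup>\<gamma>\<^sup>+\<^sup>\<theta>\<^sup>)\<^sup>k i)\<close>; the set of all such pairs is exactly one
  pillowcase class (see \<open>torus_coords_normal_form\<close> below).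
\<close>

definition pillow_rep :: "real \<Rightarrow> real \<Rightarrow> quat \<times> quat \<times> quat \<times> quat" where
  "pillow_rep \<gamma> \<theta> =
     (qi, qexp (\<gamma> *\<^sub>R qk) \<odot> qi, qexp (\<theta> *\<^sub>R qk) \<odot> qi, qexp ((\<gamma> + \<theta>) *\<^sub>R qk) \<odot> qi)"

definition conj4 :: "quat \<Rightarrow> quat \<times> quat \<times> quat \<times> quat \<Rightarrow> quat \<times> quat \<times> quat \<times> quat" where
  "conj4 g = (\<lambda>(A, B, C, D). (qconj g A, qconj g B, qconj g C, qconj g D))"

definition torus_coords :: "quat \<times> quat \<times> quat \<times> quat \<Rightarrow> pillow_point" where
  "torus_coords W = {(\<gamma>, \<theta>). \<exists>g \<in> SU2. conj4 g W = pillow_rep \<gamma> \<theta>}"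

lemma torus_coords_normal_form: "torus_coords (pillow_rep \<gamma> \<theta>) = pillow (\<gamma>, \<theta>)"
proof (intro equalityI subrelI)
  fix \<gamma>' \<theta>' assume "(\<gamma>', \<theta>') \<in> torus_coords (pillow_rep \<gamma> \<theta>)"
  then obtain g where g: "g \<in> SU2" "conj4 g (pillow_rep \<gamma> \<theta>) = pillow_rep \<gamma>' \<theta>'"
    by (auto simp: torus_coords_def)
  obtain z w where gzw: "g = (z, w)" by (cases g)
  have n: "(norm z)\<^sup>2 + (norm w)\<^sup>2 = 1"
    using g(1) by (simp add: SU2_def gzw norm_Pair)
  have "qconj g qi = qi" using g(2) by (simp add: conj4_def pillow_rep_def)
  then have "z * \<i> * cnj z - w * \<i> * cnj w = \<i>"
    by (auto simp: qconj_def gzw qi_def algebra_simps)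
  then have "\<i> * (of_real ((norm z)\<^sup>2 - (norm w)\<^sup>2)) = \<i> * 1"
    by (simp add: complex_norm_square algebra_simps del: of_real_power)
  then have "(norm z)\<^sup>2 - (norm w)\<^sup>2 = 1"
    by (metis complex_i_not_zero mult_cancel_left of_real_eq_1_iff)
  with n have "(norm w)\<^sup>2 = 0" "(norm z)\<^sup>2 = 1" by linarith+
  then have w0: "w = 0" and z1: "norm z = 1"
    using norm_ge_zero[of z] by (auto simp: power2_eq_1_iff simp del: norm_ge_zero)
  have zz: "z * cnj z = 1" using z1 by (simp add: complex_norm_square[symmetric])
  have key: "cos u' = cos u \<and> z * z * sin u = sin u'"
    if "qconj g (\<i> * complex_of_real (cos u), complex_of_real (sin u)) =
      (\<i> * complex_of_real (cos u'), complex_of_real (sin u'))" for u u' :: real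
  proof -
    have "z * (\<i> * cos u) * cnj z = \<i> * cos u'" "z * z * sin u = sin u'"
      using that by (auto simp: qconj_def gzw w0 algebra_simps)
    moreover have "z * (\<i> * cos u) * cnj z = \<i> * cos u" using zz
      by (simp add: mult.assoc mult.commute[of _ "cnj z"])
    ultimately show ?thesis by (metis complex_i_not_zero mult_cancel_left of_real_eq_iff)
  qed
  have k1: "cos \<gamma>' = cos \<gamma> \<and> z * z * sin \<gamma> = sin \<gamma>'" and k2: "cos \<theta>' = cos \<theta> \<and> z * z * sin \<theta> = sin \<theta>'"
    using g(2) by (auto intro!: key simp: conj4_def pillow_rep_def qexp_k_i)
  have "\<exists>\<epsilon>\<in>{1,-1::real}. sin \<gamma>' = \<epsilon> * sin \<gamma> \<and> sin \<theta>' = \<epsilon> * sin \<theta>"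
  proof (cases "sin \<gamma> = 0 \<and> sin \<theta> = 0")
    case True then show ?thesis using k1 k2 by auto
  next
    case False
    have "\<exists>r::real. z * z = of_real r"
    proof (cases "sin \<gamma> = 0")
      case True
      with False k2 have "z * z = of_real (sin \<theta>' / sin \<theta>)" by (simp add: field_simps)
      then show ?thesis by blast
    next
      case False
      with k1 have "z * z = of_real (sin \<gamma>' / sin \<gamma>)" by (simp add: field_simps)
      then show ?thesis by blast
    qed
    then obtain r :: real where r: "z * z = of_real r" by blast
    have "\<bar>r\<bar> = 1" using z1 r by (metis norm_mult norm_of_real mult_1)
    then have "r \<in> {1,-1}" by auto
    moreover have "r * sin \<gamma> = sin \<gamma>'" "r * sin \<theta> = sin \<theta>'"
      using k1 k2 unfolding r by (simp_all only: of_real_mult[symmetric] of_real_eq_iff)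
    ultimately show ?thesis by (intro bexI[of _ r]) simp_all
  qed
  then obtain \<epsilon> :: real where e: "\<epsilon> \<in> {1,-1}" "sin \<gamma>' = \<epsilon> * sin \<gamma>" "sin \<theta>' = \<epsilon> * sin \<theta>" by blast
  have L: "\<exists>m::int. u' = \<epsilon> * u + 2 * pi * m" if "cos u' = cos u" "sin u' = \<epsilon> * sin u" for u u'
  proof -
    have "sin u' = sin (\<epsilon> * u) \<and> cos u' = cos (\<epsilon> * u)" using that e(1) by auto
    then show ?thesis unfolding sin_cos_eq_iff by (auto simp: algebra_simps)
  qed
  show "(\<gamma>', \<theta>') \<in> pillow (\<gamma>, \<theta>)"
  proof -
    obtain m n :: int where "\<gamma>' = \<epsilon> * \<gamma> + 2 * pi * m" "\<theta>' = \<epsilon> * \<theta> + 2 * pi * n"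
      using L[of \<gamma>' \<gamma>] L[of \<theta>' \<theta>] k1 k2 e by blast
    with e(1) show ?thesis unfolding pillow_def by blast
  qed
next
  fix \<gamma>' \<theta>' assume "(\<gamma>', \<theta>') \<in> pillow (\<gamma>, \<theta>)"
  then obtain \<epsilon> :: real and m n :: int where e: "\<epsilon> \<in> {1,-1}"
    and eq: "\<gamma>' = \<epsilon> * \<gamma> + 2 * pi * m" "\<theta>' = \<epsilon> * \<theta> + 2 * pi * n"
    by (auto simp: pillow_def)
  define z where "z = (if \<epsilon> = 1 then 1 else \<i>)"
  have z: "z * cnj z = 1" "z * z = \<epsilon>" "norm z = 1" using e by (auto simp: z_def)
  have cs: "cos (\<epsilon> * u + 2 * pi * k) = cos u \<and> sin (\<epsilon> * u + 2 * pi * k) = \<epsilon> * sin u" for u and k :: int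
  proof -
    have "sin (\<epsilon> * u + 2 * pi * k) = sin (\<epsilon> * u) \<and> cos (\<epsilon> * u + 2 * pi * k) = cos (\<epsilon> * u)"
      unfolding sin_cos_eq_iff by (rule exI[of _ k]) simp
    then show ?thesis using e by auto
  qed
  have C: "qconj (z, 0) (\<i> * complex_of_real (cos u), complex_of_real (sin u)) =
      (\<i> * complex_of_real (cos (\<epsilon> * u + 2 * pi * k)), complex_of_real (sin (\<epsilon> * u + 2 * pi * k)))"
    for u and k :: int
  proof -
    have "z * (\<i> * r) * cnj z = (z * cnj z) * (\<i> * r)" "z * r' * z = (z * z) * r'" for r r'
      by (simp_all only: ac_simps)
    then have "z * (\<i> * r) * cnj z = \<i> * r" "z * r' * z = \<epsilon> * r'" for r r' :: complex
      unfolding z(1,2) by (simp_all only: mult_1)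
    moreover have "qconj (z, 0) (r, r') = (z * r * cnj z, z * r' * z)" for r r'
      by (simp add: qconj_def)
    ultimately show ?thesis
      unfolding cs[THEN conjunct1] cs[THEN conjunct2] by (simp only: of_real_mult)
  qed
  have s: "\<gamma>' + \<theta>' = \<epsilon> * (\<gamma> + \<theta>) + 2 * pi * of_int (m + n)" unfolding eq by (simp add: algebra_simps)
  have i: "qconj (z, 0) qi = qi" using C[of 0 0] by (simp add: qi_def)
  have "conj4 (z, 0) (pillow_rep \<gamma> \<theta>) = pillow_rep \<gamma>' \<theta>'"
    unfolding conj4_def pillow_rep_def qexp_k_i s unfolding eq by (simp only: prod.case C[of \<gamma> m] C[of \<theta> n] C[of "\<gamma> + \<theta>" "m + n"] i)
  moreover have "(z, 0) \<in> SU2" using z(3) by (simp add: SU2_def norm_Pair)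
  ultimately show "(\<gamma>', \<theta>') \<in> torus_coords (pillow_rep \<gamma> \<theta>)" unfolding torus_coords_def by blast
qed


section \<open>The perturbed character variety of \<open>C\<^sub>3\<close>\<close>

text \<open>
  \<open>C\<^sub>3\<close> has six arcs.  The upper ones carry the meridians \<open>a\<close> (from sphere 3 to sphere 1), \<open>x\<close> (from
  sphere 1 to sphere 2) and \<open>c\<close> (from sphere 2 to sphere 3); the lower ones carry \<open>b\<close>, \<open>y\<close>, \<open>d\<close>.
  The relation at sphere 3 is \<open>d = c a\<^sup>-\<^sup>1 b\<close>, so a representation is recorded as \<open>(a, b, c, x)\<close>.

  The perturbation curve is the unknotted loop that encircles the three upper arcs once each.  In a
  planar diagram without self-crossings, its strand with meridian \<open>p\<close> passes over \<open>a\<close>, then under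
  \<open>x\<close> (becoming \<open>x p x\<^sup>-\<^sup>1\<close>), then over \<open>x\<close>, over \<open>c\<close>, and back under \<open>c\<close> and \<open>a\<close>.  Its longitude
  is therefore \<open>a c\<^sup>-\<^sup>1 x\<close>, and the perturbation condition for the class function of strength \<open>t\<close>
  (perturbing function \<open>sin\<close>) is \<open>p = exp (t Im (a c\<^sup>-\<^sup>1 x))\<close>.  The Wirtinger relations at the
  overcrossings give the words at spheres 1 and 2.
\<close>

type_synonym rep_C3 = "quat \<times> quat \<times> quat \<times> quat"

definition d_word :: "rep_C3 \<Rightarrow> quat" where
  "d_word = (\<lambda>(a, b, c, x). c \<odot> qcnj a \<odot> b)"

definition pert :: "real \<Rightarrow> rep_C3 \<Rightarrow> quat" where
  "pert t = (\<lambda>(a, b, c, x). qexp (t *\<^sub>R qIm (a \<odot> qcnj c \<odot> x)))"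

definition y_word :: "real \<Rightarrow> rep_C3 \<Rightarrow> quat" where
  "y_word t = (\<lambda>(a, b, c, x). let p = pert t (a, b, c, x) in x \<odot> qcnj p \<odot> qcnj a \<odot> p \<odot> b)"

definition sphere1 :: "real \<Rightarrow> rep_C3 \<Rightarrow> quat \<times> quat \<times> quat \<times> quat" where
  "sphere1 t = (\<lambda>(a, b, c, x). let p = pert t (a, b, c, x) in
      (qconj (qcnj p) a, b, x, y_word t (a, b, c, x)))"

definition sphere2 :: "real \<Rightarrow> rep_C3 \<Rightarrow> quat \<times> quat \<times> quat \<times> quat" where
  "sphere2 t = (\<lambda>(a, b, c, x). let q = qconj x (qcnj (pert t (a, b, c, x))) in
      (qconj q x, y_word t (a, b, c, x), qconj q c, d_word (a, b, c, x)))"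

definition sphere3 :: "rep_C3 \<Rightarrow> quat \<times> quat \<times> quat \<times> quat" where
  "sphere3 = (\<lambda>(a, b, c, x). (a, b, c, d_word (a, b, c, x)))"

text \<open>
  Over \<open>\<gamma> = 0\<close>, \<open>\<theta> = \<pi>/2\<close> write \<open>x = cos \<alpha> k + sin \<alpha> e\<^sup>\<beta>\<^sup>k i\<close>.  For \<open>\<beta> = 0\<close> and \<open>\<beta> = \<pi>\<close> (the two
  alternatives of the assumption of \<open>local_form\<close>) the words take the following form; it fixes the
  orientation conventions, in particular the sign of the exponent in \<^const>\<open>pert\<close>.
\<close>

definition v_circle :: "real \<Rightarrow> quat" where "v_circle \<phi> = cos \<phi> *\<^sub>R qi + sin \<phi> *\<^sub>R qk"

lemma v_circle: "v_circle \<phi> = (\<i> * cos \<phi>, \<i> * sin \<phi>)"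
  by (simp add: v_circle_def qi_def qk_def complex_eq_iff)

lemma double_angle:
  "cos (\<phi> + 2 * u) = cos \<phi> * (cos u * cos u - sin u * sin u) - 2 * sin \<phi> * (sin u * cos u)"
  "sin (\<phi> + 2 * u) = sin \<phi> * (cos u * cos u - sin u * sin u) + 2 * cos \<phi> * (sin u * cos u)"
  for \<phi> u :: real
  by (simp_all add: cos_add sin_add cos_double sin_double power2_eq_square)

lemma qconj_e_v:
  "qconj (complex_of_real (cos u), - complex_of_real (sin u)) (v_circle \<phi>) = v_circle (\<phi> + 2 * u)"
  "qconj (complex_of_real (cos u), - complex_of_real (sin u)) qj = qj"
proof -
  show "qconj (complex_of_real (cos u), - complex_of_real (sin u)) (v_circle \<phi>) = v_circle (\<phi> + 2 * u)"
    by (simp add: qconj_def v_circle complex_eq_iff double_angle) (simp add: algebra_simps)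
  have "cos u * cos u + sin u * sin u = 1"
    using sin_cos_squared_add[of u] by (simp add: power2_eq_square)
  then show "qconj (complex_of_real (cos u), - complex_of_real (sin u)) qj = qj"
    by (simp add: qconj_def qj_def complex_eq_iff algebra_simps)
qed

lemma qconj_v_e: "qconj (v_circle \<phi>) (complex_of_real r, complex_of_real s) = (complex_of_real r, - complex_of_real s)"
proof -
  have "cos \<phi> * cos \<phi> + sin \<phi> * sin \<phi> = 1"
    using sin_cos_squared_add[of \<phi>] by (simp add: power2_eq_square)
  then have "r * (cos \<phi> * cos \<phi> + sin \<phi> * sin \<phi>) = r" for r by simp
  then have "r * (cos \<phi> * cos \<phi>) + r * (sin \<phi> * sin \<phi>) = r" for r
    by (simp only: distrib_left)
  from this[of r] this[of s] show ?thesis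
    by (simp add: qconj_def v_circle complex_eq_iff algebra_simps)
qed

lemma local_form:
  assumes "(\<phi> = pi / 2 - \<alpha> \<and> u = t * sin \<alpha>) \<or> (\<phi> = pi / 2 + \<alpha> \<and> u = - (t * sin \<alpha>))"
  defines "\<rho> \<equiv> (qi, qi, qj, v_circle \<phi>)"
  shows "pert t \<rho> = qexp (- u *\<^sub>R qj)"
   and "y_word t \<rho> = v_circle (\<phi> + 2 * u)"
   and "sphere2 t \<rho> = (v_circle (\<phi> + 2 * u), v_circle (\<phi> + 2 * u), qj, qj)"
   and "sphere1 t \<rho> = (v_circle (- 2 * u), v_circle 0, v_circle \<phi>, v_circle (\<phi> + 2 * u))"
proof -
  have u: "u = t * cos \<phi>" using assms(1) by (auto simp: cos_diff cos_add)
  have "t *\<^sub>R qIm (qi \<odot> qcnj qj \<odot> v_circle \<phi>) = - u *\<^sub>R qj"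
    by (simp add: u qi_def qj_def v_circle complex_eq_iff)
  then show p: "pert t \<rho> = qexp (- u *\<^sub>R qj)" by (simp add: pert_def \<rho>_def)
  have pm: "pert t \<rho> = (complex_of_real (cos u), - complex_of_real (sin u))" using qexp_j[of "- u"] p by simp
  have dw: "d_word \<rho> = qj" by (simp add: d_word_def \<rho>_def qi_def qj_def)
  show y: "y_word t \<rho> = v_circle (\<phi> + 2 * u)"
    using pm by (simp add: y_word_def \<rho>_def Let_def qi_def v_circle complex_eq_iff double_angle)
      (simp add: algebra_simps)
  have q: "qconj (v_circle \<phi>) (qcnj (pert t \<rho>)) = (complex_of_real (cos u), - complex_of_real (sin u))"
    unfolding pm using qconj_v_e[of \<phi> "cos u" "sin u"] by simp
  show "sphere2 t \<rho> = (v_circle (\<phi> + 2 * u), v_circle (\<phi> + 2 * u), qj, qj)"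
    using q y dw qconj_e_v(1)[of u \<phi>] qconj_e_v(2)[of u] by (simp add: sphere2_def \<rho>_def Let_def)
  have "v_circle 0 = qi" by (simp add: v_circle_def)
  moreover have "qcnj (pert t \<rho>) = (complex_of_real (cos (- u)), - complex_of_real (sin (- u)))" by (simp add: pm)
  ultimately show "sphere1 t \<rho> = (v_circle (- 2 * u), v_circle 0, v_circle \<phi>, v_circle (\<phi> + 2 * u))"
    using y qconj_e_v(1)[of "- u" 0] by (simp add: sphere1_def \<rho>_def Let_def)
qed

text \<open>
  The space of representations before dividing by conjugation.  Tracelessness of the remaining
  boundary words is automatic, as they are conjugates of these.
\<close>

definition rep_space :: "real \<Rightarrow> rep_C3 set" where
  "rep_space t = {(a, b, c, x). {a, b, c, x} \<subseteq> traceless \<and>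
      qRe (d_word (a, b, c, x)) = 0 \<and> qRe (y_word t (a, b, c, x)) = 0}"

definition conj_class :: "rep_C3 \<Rightarrow> rep_C3 set" where
  "conj_class \<rho> = {conj4 g \<rho> | g. g \<in> SU2}"

definition char_var :: "real \<Rightarrow> rep_C3 set set" where
  "char_var t = conj_class ` rep_space t"

text \<open>The boundary restriction maps (constant on each class, whence \<^const>\<open>the_elem\<close>).\<close>

definition p1 :: "real \<Rightarrow> rep_C3 set \<Rightarrow> pillow_point" where
  "p1 t r = the_elem ((\<lambda>\<rho>. torus_coords (sphere1 t \<rho>)) ` r)"

definition p2 :: "real \<Rightarrow> rep_C3 set \<Rightarrow> pillow_point" where
  "p2 t r = the_elem ((\<lambda>\<rho>. torus_coords (sphere2 t \<rho>)) ` r)"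

definition p3 :: "rep_C3 set \<Rightarrow> pillow_point" where
  "p3 r = the_elem ((\<lambda>\<rho>. torus_coords (sphere3 \<rho>)) ` r)"

definition C3_reg :: "real \<Rightarrow> rep_C3 set set" where
  "C3_reg t = {r \<in> char_var t.
      p1 t r \<in> pillow_smooth \<and> p2 t r \<in> pillow_smooth \<and> p3 r \<in> pillow_smooth}"


section \<open>The partial fiber product\<close>

definition A_third :: "pillow_point set" where
  "A_third = pillow ` {(\<gamma>, \<theta>). \<exists>n::int. 3 * \<theta> - \<gamma> = 2 * pi * of_int n}"

definition F_third :: "real \<Rightarrow> (pillow_point \<times> rep_C3 set) set" where
  "F_third t = {(z, r). z \<in> A_third \<and> r \<in> C3_reg t \<and> p1 t r = z}"

text \<open>
  The reversed sign of the symplectic form on the second pillowcase affects neither points,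
  transversality nor embeddedness, so it does not appear.
\<close>

definition F_map :: "real \<Rightarrow> pillow_point \<times> rep_C3 set \<Rightarrow> pillow_point \<times> pillow_point" where
  "F_map t = (\<lambda>(z, r). (p2 t r, p3 r))"


subsection \<open>Transversality\<close>

text \<open>
  Tangent vectors at a smooth point of the pillowcase are vectors of the plane, once a lift \<open>w\<close> of the
  point is chosen.  \<open>A_velocities w\<close> is the tangent space of the rational line, and
  \<open>p1_velocities t \<rho> w\<close> the image of the tangent space of the character variety under \<open>dp\<^sub>1\<close>, both
  expressed through velocities of curves; the curve in the character variety is lifted to
  representations, and its image in the pillowcase to the plane.
\<close>

definition A_velocities :: "real \<times> real \<Rightarrow> (real \<times> real) set" where
  "A_velocities w = {v. \<exists>h. h 0 = w \<and> (\<forall>\<^sub>F s in nhds 0. pillow (h s) \<in> A_third) \<and>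
      (h has_vector_derivative v) (at (0::real))}"

definition p1_velocities :: "real \<Rightarrow> rep_C3 \<Rightarrow> real \<times> real \<Rightarrow> (real \<times> real) set" where
  "p1_velocities t \<rho> w = {v. \<exists>\<kappa> h. \<kappa> 0 = \<rho> \<and> h 0 = w \<and>
      (\<forall>\<^sub>F s in nhds 0. \<kappa> s \<in> rep_space t \<and> torus_coords (sphere1 t (\<kappa> s)) = pillow (h s)) \<and>
      \<kappa> differentiable (at (0::real)) \<and> (h has_vector_derivative v) (at 0)}"

text \<open>
  The tangent space at \<open>\<rho>\<close> of the product of four 2-spheres in which \<^const>\<open>rep_space\<close> is cut out by
  two equations.  At a regular point \<^const>\<open>rep_space\<close> is a smooth 6-manifold, so that the velocities
  of its curves do form its tangent space, and the character variety is a smooth 3-manifold.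
\<close>

definition spheres_tangent :: "rep_C3 \<Rightarrow> rep_C3 set" where
  "spheres_tangent = (\<lambda>(a, b, c, x). {(a', b', c', x').
      qRe a' = 0 \<and> qRe b' = 0 \<and> qRe c' = 0 \<and> qRe x' = 0 \<and>
      a' \<bullet> a = 0 \<and> b' \<bullet> b = 0 \<and> c' \<bullet> c = 0 \<and> x' \<bullet> x = 0})"

definition regular_rep :: "real \<Rightarrow> rep_C3 \<Rightarrow> bool" where
  "regular_rep t \<rho> \<longleftrightarrow> \<rho> \<in> rep_space t \<and>
     (\<exists>D. ((\<lambda>\<sigma>. (qRe (d_word \<sigma>), qRe (y_word t \<sigma>))) has_derivative D) (at \<rho>) \<and>
          D ` spheres_tangent \<rho> = UNIV)"

text \<open>
  Transversality of \<open>A\<^sub>1\<^sub>/\<^sub>3\<close> and \<open>p\<^sub>1\<close> at a point of the fiber product.  The condition does not depend on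
  the representative \<open>\<rho>\<close> nor on the lift \<open>w\<close>.
\<close>

definition transverse_at :: "real \<Rightarrow> pillow_point \<times> rep_C3 set \<Rightarrow> bool" where
  "transverse_at t = (\<lambda>(z, r). \<exists>\<rho> \<in> r. \<exists>w. pillow w = z \<and> regular_rep t \<rho> \<and>
      {u + v | u v. u \<in> A_velocities w \<and> v \<in> p1_velocities t \<rho> w} = UNIV)"


subsection \<open>Topologies and embeddedness\<close>

definition quotient_top :: "'a topology \<Rightarrow> ('a \<Rightarrow> 'b) \<Rightarrow> 'b topology" where
  "quotient_top X f = topology (\<lambda>U. U \<subseteq> f ` topspace X \<and> openin X {x \<in> topspace X. f x \<in> U})"

lemma istopology_quotient_top:
  "istopology (\<lambda>U. U \<subseteq> f ` topspace X \<and> openin X {x \<in> topspace X. f x \<in> U})"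
  unfolding istopology_def
proof (intro conjI allI impI; (elim conjE)?)
  fix S T assume "openin X {x \<in> topspace X. f x \<in> S}" "openin X {x \<in> topspace X. f x \<in> T}"
  then have "openin X ({x \<in> topspace X. f x \<in> S} \<inter> {x \<in> topspace X. f x \<in> T})" by blast
  moreover have "{x \<in> topspace X. f x \<in> S} \<inter> {x \<in> topspace X. f x \<in> T} = {x \<in> topspace X. f x \<in> S \<inter> T}" by auto
  ultimately show "openin X {x \<in> topspace X. f x \<in> S \<inter> T}" by simp
next
  fix K assume K: "\<forall>U\<in>K. U \<subseteq> f ` topspace X \<and> openin X {x \<in> topspace X. f x \<in> U}"
  have "openin X (\<Union>U\<in>K. {x \<in> topspace X. f x \<in> U})" using K by blast
  moreover have "(\<Union>U\<in>K. {x \<in> topspace X. f x \<in> U}) = {x \<in> topspace X. f x \<in> \<Union>K}" by auto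
  ultimately show "openin X {x \<in> topspace X. f x \<in> \<Union>K}" by simp
qed auto

lemma openin_quotient_top:
  "openin (quotient_top X f) U \<longleftrightarrow> U \<subseteq> f ` topspace X \<and> openin X {x \<in> topspace X. f x \<in> U}"
  unfolding quotient_top_def by (simp add: istopology_quotient_top)

lemma quotient_map_quotient_top: "quotient_map X (quotient_top X f) f"
proof -
  have "topspace (quotient_top X f) = f ` topspace X"
  proof
    show "topspace (quotient_top X f) \<subseteq> f ` topspace X"
      using openin_topspace[of "quotient_top X f"] unfolding openin_quotient_top by (rule conjunct1)
    have "{x \<in> topspace X. f x \<in> f ` topspace X} = topspace X" by auto
    then show "f ` topspace X \<subseteq> topspace (quotient_top X f)"
      by (intro openin_subset) (simp add: openin_quotient_top)
  qed
  then show ?thesis by (simp add: quotient_map_def openin_quotient_top)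
qed

definition pillow_top :: "pillow_point topology" where
  "pillow_top = quotient_top euclidean pillow"

definition char_var_top :: "real \<Rightarrow> rep_C3 set topology" where
  "char_var_top t = quotient_top (top_of_set (rep_space t)) conj_class"

definition F_top :: "real \<Rightarrow> (pillow_point \<times> rep_C3 set) topology" where
  "F_top t = subtopology (prod_topology pillow_top (char_var_top t)) (F_third t)"

text \<open>
  Embedded means a homeomorphism onto the image.  Every smooth embedding is one, so to fail this is
  the stronger assertion.
\<close>

definition F_embedded :: "real \<Rightarrow> bool" where
  "F_embedded t \<longleftrightarrow> embedding_map (F_top t) (prod_topology pillow_top pillow_top) (F_map t)"

end

theory Submission
  imports Defs
begin

text \<open>
  The representations \<open>(i, i, j, v(\<phi>))\<close> form a circle on which \<open>p\<^sub>2\<close> and \<open>p\<^sub>3\<close> are constantly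
  \<open>(0, \<pi>/2)\<close> and \<open>p\<^sub>1 = (2u, \<phi> + 2u)\<close> with \<open>u = t cos \<phi>\<close>.  It meets \<open>A\<^sub>1\<^sub>/\<^sub>3\<close> where
  \<open>3\<phi> + 4t cos \<phi>\<close> is a multiple of \<open>2\<pi>\<close>, and for small \<open>t\<close> there is one such \<open>\<phi>\<close> near each of
  \<open>0\<close>, \<open>2\<pi>/3\<close> and \<open>4\<pi>/3\<close>.  Moving along the circle and along the line of slope \<open>1/3\<close> already spans
  the tangent plane of \<open>P\<^sub>1\<close>, because \<open>(-2t sin \<phi>, 1 - 2t sin \<phi>)\<close> and \<open>(3, 1)\<close> have determinant
  \<open>4t sin \<phi> - 3\<close>.  Three points with one image contradict injectivity.
\<close>

section \<open>Conjugation by unit quaternions\<close>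

lemma qmult_assoc: "(p \<odot> q) \<odot> r = p \<odot> (q \<odot> r)"
  by (cases p; cases q; cases r) (simp add: algebra_simps)

lemma qmult_one [simp]: "qone \<odot> q = q" "q \<odot> qone = q"
  by (cases q; simp add: qone_def)+

lemma qmult_add: "p \<odot> (q + r) = p \<odot> q + p \<odot> r" "(q + r) \<odot> p = q \<odot> p + r \<odot> p"
  by (cases p; cases q; cases r; simp add: algebra_simps)+

lemma qmult_scaleR: "p \<odot> (s *\<^sub>R q) = s *\<^sub>R (p \<odot> q)" "(s *\<^sub>R q) \<odot> p = s *\<^sub>R (q \<odot> p)"
  by (cases p; cases q; simp add: algebra_simps)+

lemma qcnj_qmult: "qcnj (p \<odot> q) = qcnj q \<odot> qcnj p"
  by (cases p; cases q) (simp add: algebra_simps)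

lemma qcnj_qcnj [simp]: "qcnj (qcnj q) = q"
  by (cases q) simp

lemma norm_qcnj [simp]: "norm (qcnj q) = norm q"
  by (cases q) (simp add: norm_Pair)

lemma qmult_qcnj: "q \<odot> qcnj q = (norm q)\<^sup>2 *\<^sub>R qone" "qcnj q \<odot> q = (norm q)\<^sup>2 *\<^sub>R qone"
  by (cases q; simp add: norm_Pair qone_def scaleR_conv_of_real complex_norm_square mult.commute
      flip: of_real_power)+

lemma SU2_qcnj [simp]: "g \<in> SU2 \<Longrightarrow> g \<odot> qcnj g = qone" "g \<in> SU2 \<Longrightarrow> qcnj g \<odot> g = qone"
  by (simp_all add: qmult_qcnj SU2_def)

lemma SU2_qcnj_cancel [simp]:
  assumes "g \<in> SU2"
  shows "g \<odot> (qcnj g \<odot> q) = q" "qcnj g \<odot> (g \<odot> q) = q"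
  using assms by (simp_all flip: qmult_assoc)

text \<open>\<open>q \<odot> qcnj q\<close> is the squared norm times \<open>qone\<close>, hence
  central, and can be pulled out of the middle of the product; norms being nonnegative, the squares
  can then be dropped.\<close>

lemma norm_qmult: "norm (p \<odot> q) = norm p * norm q"
proof -
  have "(norm (p \<odot> q))\<^sup>2 *\<^sub>R qone = (p \<odot> q) \<odot> qcnj (p \<odot> q)"
    by (simp add: qmult_qcnj)
  also have "\<dots> = p \<odot> (q \<odot> qcnj q) \<odot> qcnj p"
    by (simp add: qmult_assoc qcnj_qmult)
  also have "\<dots> = (norm p * norm q)\<^sup>2 *\<^sub>R qone"
    by (simp add: qmult_qcnj qmult_scaleR power_mult_distrib)
  finally have "(norm (p \<odot> q))\<^sup>2 = (norm p * norm q)\<^sup>2"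
    by (simp add: qone_def)
  then show ?thesis by simp
qed

lemma qmult_in_SU2: "p \<in> SU2 \<Longrightarrow> q \<in> SU2 \<Longrightarrow> p \<odot> q \<in> SU2"
  and qcnj_in_SU2: "p \<in> SU2 \<Longrightarrow> qcnj p \<in> SU2"
  and qone_in_SU2: "qone \<in> SU2"
  by (simp_all add: SU2_def norm_qmult) (simp add: qone_def norm_Pair)

text \<open>The trace property; it is what makes \<open>qRe\<close> invariant under
  conjugation.\<close>

lemma qRe_qmult_commute: "qRe (p \<odot> q) = qRe (q \<odot> p)"
  by (cases p; cases q) (simp add: algebra_simps)

lemma qconj_qconj: "qconj h (qconj g q) = qconj (h \<odot> g) q"
  by (simp add: qconj_def qmult_assoc qcnj_qmult)

lemma qconj_one [simp]: "qconj qone q = q"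
  by (simp add: qconj_def) (simp add: qone_def qmult_def)

lemma qconj_qcnj: "qconj g (qcnj q) = qcnj (qconj g q)"
  by (simp add: qconj_def qmult_assoc qcnj_qmult)

text \<open>Conjugation by a fixed unit quaternion is an isometric real algebra automorphism that
  commutes with \<open>qcnj\<close>, \<open>qIm\<close> and \<open>qexp\<close>. Every word formed
  from these operations is therefore equivariant.\<close>

context
  fixes g :: quat
  assumes g: "g \<in> SU2"
begin

lemma qconj_qmult: "qconj g (p \<odot> q) = qconj g p \<odot> qconj g q"
  using g by (simp add: qconj_def qmult_assoc)

lemma qRe_qconj: "qRe (qconj g q) = qRe q"
  using g qRe_qmult_commute[of "g \<odot> q" "qcnj g"] by (simp add: qconj_def)

lemma norm_qconj: "norm (qconj g q) = norm q"
  using g by (simp add: qconj_def norm_qmult SU2_def)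

lemma qconj_qone: "qconj g qone = qone"
  using g by (simp add: qconj_def)

lemma qconj_qIm: "qIm (qconj g q) = qconj g (qIm q)"
proof -
  have "qconj g (qIm q + qRe q *\<^sub>R qone) = qconj g (qIm q) + qRe q *\<^sub>R qone"
    using g by (simp add: qconj_def qmult_add qmult_scaleR)
  moreover have "qIm q + qRe q *\<^sub>R qone = q" by (simp add: qIm_def)
  ultimately have "qconj g q = qconj g (qIm q) + qRe q *\<^sub>R qone" by simp
  then show ?thesis
    unfolding qIm_def[of "qconj g q"] qRe_qconj by simp
qed

lemma qconj_scaleR: "qconj g (s *\<^sub>R q) = s *\<^sub>R qconj g q"
  by (simp add: qconj_def qmult_scaleR)

lemma qconj_add: "qconj g (p + q) = qconj g p + qconj g q"
  by (simp add: qconj_def qmult_add)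

lemma qconj_qexp: "qexp (qconj g q) = qconj g (qexp q)"
  by (simp add: qexp_def qconj_qIm qRe_qconj norm_qconj qconj_scaleR qconj_add qconj_qone)

lemma qconj_qconj_left: "qconj (qconj g p) (qconj g q) = qconj g (qconj p q)"
  by (simp add: qconj_def[of "qconj g p"] qconj_def[of p] qconj_qmult flip: qconj_qcnj)

lemma conj4_equivariance:
  shows pert_conj4: "pert t (conj4 g \<rho>) = qconj g (pert t \<rho>)"
    and y_word_conj4: "y_word t (conj4 g \<rho>) = qconj g (y_word t \<rho>)"
    and d_word_conj4: "d_word (conj4 g \<rho>) = qconj g (d_word \<rho>)"
    and sphere1_conj4: "sphere1 t (conj4 g \<rho>) = conj4 g (sphere1 t \<rho>)"
    and sphere2_conj4: "sphere2 t (conj4 g \<rho>) = conj4 g (sphere2 t \<rho>)"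
    and sphere3_conj4: "sphere3 (conj4 g \<rho>) = conj4 g (sphere3 \<rho>)"
proof -
  obtain a b c x where \<rho>: "\<rho> = (a, b, c, x)" by (cases \<rho>)
  show p: "pert t (conj4 g \<rho>) = qconj g (pert t \<rho>)"
    by (simp add: \<rho> conj4_def pert_def qconj_qIm qconj_qexp
        flip: qconj_qcnj qconj_qmult qconj_scaleR)
  show y: "y_word t (conj4 g \<rho>) = qconj g (y_word t \<rho>)"
    using p by (simp add: \<rho> conj4_def y_word_def Let_def qconj_qmult qconj_qcnj)
  show d: "d_word (conj4 g \<rho>) = qconj g (d_word \<rho>)"
    by (simp add: \<rho> conj4_def d_word_def qconj_qmult qconj_qcnj)
  show "sphere1 t (conj4 g \<rho>) = conj4 g (sphere1 t \<rho>)"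
    using p y by (simp add: \<rho> conj4_def sphere1_def Let_def qconj_qconj_left flip: qconj_qcnj)
  show "sphere2 t (conj4 g \<rho>) = conj4 g (sphere2 t \<rho>)"
    using p y d by (simp add: \<rho> conj4_def sphere2_def Let_def qconj_qconj_left flip: qconj_qcnj)
  show "sphere3 (conj4 g \<rho>) = conj4 g (sphere3 \<rho>)"
    using d by (simp add: \<rho> conj4_def sphere3_def)
qed

end

section \<open>Boundary restrictions on conjugacy classes\<close>

lemma conj4_conj4: "conj4 h (conj4 g W) = conj4 (h \<odot> g) W"
  by (simp add: conj4_def qconj_qconj split: prod.splits)

lemma conj4_one: "conj4 qone W = W"
  by (simp add: conj4_def split: prod.splits)

lemma torus_coords_conj4:
  assumes g: "g \<in> SU2"
  shows "torus_coords (conj4 g W) = torus_coords W"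
proof -
  \<comment> \<open>One inclusion for arbitrary \<open>h\<close> and \<open>V\<close> suffices:
    applying it again to \<open>qcnj g\<close> undoes the first conjugation and gives the reverse
    inclusion.\<close>
  have sub: "torus_coords (conj4 h V) \<subseteq> torus_coords V" if "h \<in> SU2" for h V
    using that by (auto simp: torus_coords_def conj4_conj4 intro: qmult_in_SU2)
  have "conj4 (qcnj g) (conj4 g W) = W"
    using g by (simp add: conj4_conj4 conj4_one)
  then show ?thesis
    using sub[OF g, of W] sub[OF qcnj_in_SU2[OF g], of "conj4 g W"] by simp
qed

lemma conj_class_refl: "\<rho> \<in> conj_class \<rho>"
  unfolding conj_class_def
  by (intro CollectI exI[of _ qone] conjI qone_in_SU2) (simp add: conj4_one)

text \<open>Equivariance of the boundary words makes each restriction constant on the class, so its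
  image is a singleton and \<open>the_elem\<close> may be evaluated at any representative.\<close>

lemma restriction_conj_class:
  shows p1_conj_class: "p1 t (conj_class \<rho>) = torus_coords (sphere1 t \<rho>)"
    and p2_conj_class: "p2 t (conj_class \<rho>) = torus_coords (sphere2 t \<rho>)"
    and p3_conj_class: "p3 (conj_class \<rho>) = torus_coords (sphere3 \<rho>)"
proof -
  have *: "the_elem (f ` conj_class \<rho>) = f \<rho>"
    if "\<And>g. g \<in> SU2 \<Longrightarrow> f (conj4 g \<rho>) = f \<rho>" for f :: "rep_C3 \<Rightarrow> pillow_point"
  proof -
    have "f ` conj_class \<rho> = {f \<rho>}"
      using that conj_class_refl[of \<rho>] by (auto simp: conj_class_def)
    then show ?thesis by simp
  qed
  show "p1 t (conj_class \<rho>) = torus_coords (sphere1 t \<rho>)"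
    unfolding p1_def by (rule *) (simp add: sphere1_conj4 torus_coords_conj4)
  show "p2 t (conj_class \<rho>) = torus_coords (sphere2 t \<rho>)"
    unfolding p2_def by (rule *) (simp add: sphere2_conj4 torus_coords_conj4)
  show "p3 (conj_class \<rho>) = torus_coords (sphere3 \<rho>)"
    unfolding p3_def by (rule *) (simp add: sphere3_conj4 torus_coords_conj4)
qed

section \<open>The circle of representations over \<open>(0, \<pi>/2)\<close>\<close>

text \<open>Every lift of a corner has both coordinates in \<pi>Z, so one nonvanishing sine excludes
  all four corners.\<close>

lemma pillow_smoothI:
  assumes "sin \<gamma> \<noteq> 0 \<or> sin \<theta> \<noteq> 0"
  shows "pillow (\<gamma>, \<theta>) \<in> pillow_smooth"
proof -
  have "(\<gamma>, \<theta>) \<in> pillow (\<gamma>, \<theta>)"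
    by (force simp: pillow_def)
  moreover have "sin \<gamma>' = 0 \<and> sin \<theta>' = 0" if "(\<gamma>', \<theta>') \<in> pillow (c, d)" "c \<in> {0, pi}" "d \<in> {0, pi}"
    for \<gamma>' \<theta>' c d
  proof -
    have "sin (e * c + 2 * pi * of_int m) = 0" if "c \<in> {0, pi}" "e \<in> {1, -1}" for e c :: real and m
    proof -
      have "sin (2 * pi * of_int m) = 0" "sin (e * c) = 0"
        using that by auto
      then show ?thesis by (simp add: sin_add)
    qed
    with that show ?thesis by (force simp: pillow_def)
  qed
  ultimately show ?thesis
    using assms by (fastforce simp: pillow_smooth_def pillow_corners_def)
qed

lemma pillow_rep_circle:
  "pillow_rep \<gamma> \<theta> = ((\<i>, 0), (\<i> * cos \<gamma>, sin \<gamma>), (\<i> * cos \<theta>, sin \<theta>), (\<i> * cos (\<gamma> + \<theta>), sin (\<gamma> + \<theta>)))"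
  by (simp add: pillow_rep_def qexp_k_i) (simp add: qi_def)

lemma e_j_in_SU2: "(complex_of_real (cos u), - complex_of_real (sin u)) \<in> SU2"
  by (simp add: SU2_def norm_Pair)

definition circle_rep :: "real \<Rightarrow> rep_C3" where
  "circle_rep \<phi> = (qi, qi, qj, v_circle \<phi>)"

text \<open>This is 2u, where u = t cos \<phi> is the angle of the perturbation element on the
  circle.\<close>

definition shift :: "real \<Rightarrow> real \<Rightarrow> real" where
  "shift t \<phi> = 2 * (t * cos \<phi>)"

lemma circle_rep_words:
  shows "y_word t (circle_rep \<phi>) = v_circle (\<phi> + shift t \<phi>)"
    and "sphere1 t (circle_rep \<phi>) =
      (v_circle (- shift t \<phi>), v_circle 0, v_circle \<phi>, v_circle (\<phi> + shift t \<phi>))"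
    and "sphere2 t (circle_rep \<phi>) =
      (v_circle (\<phi> + shift t \<phi>), v_circle (\<phi> + shift t \<phi>), qj, qj)"
  \<comment> \<open>With \<alpha> = \<pi>/2 - \<phi> one has t sin \<alpha> = t cos \<phi>; since
    \<phi> is arbitrary, the first alternative already covers the whole circle.\<close>
  using local_form[of \<phi> "pi / 2 - \<phi>" "t * cos \<phi>" t]
  by (simp_all add: circle_rep_def shift_def sin_diff)

lemma d_word_circle_rep: "d_word (circle_rep \<phi>) = qj"
  by (simp add: circle_rep_def d_word_def qi_def qj_def)

lemma circle_rep_in_rep_space: "circle_rep \<phi> \<in> rep_space t"
proof -
  have "qRe (y_word t (circle_rep \<phi>)) = 0"
    by (simp add: circle_rep_words v_circle)
  moreover have "norm (v_circle \<phi>) = 1"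
    by (simp add: v_circle norm_Pair norm_mult)
  ultimately show ?thesis
    using d_word_circle_rep[of \<phi>]
    by (simp add: circle_rep_def rep_space_def traceless_def SU2_def qi_def qj_def v_circle norm_Pair)
qed

lemma torus_coords_sphere1_circle_rep:
  "torus_coords (sphere1 t (circle_rep \<phi>)) = pillow (shift t \<phi>, \<phi> + shift t \<phi>)"
proof -
  \<comment> \<open>Conjugation by \<open>e\<close> rotates the i-k circle about j by
    \<open>shift t \<phi>\<close>, bringing the first entry to i. Conjugation by \<open>g0\<close>
    fixes i and carries k to j, moving the words to the i-j circle of
    \<open>pillow_rep\<close>.\<close>
  define e g0 where "e = (complex_of_real (cos (shift t \<phi> / 2)), - complex_of_real (sin (shift t \<phi> / 2)))"
    and "g0 = (cis (- (pi / 4)), 0 :: complex)"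
  have "g0 \<in> SU2" by (simp add: g0_def SU2_def norm_Pair)
  moreover have "e \<in> SU2" unfolding e_def by (rule e_j_in_SU2)
  moreover have "conj4 (g0 \<odot> e) (sphere1 t (circle_rep \<phi>)) = pillow_rep (shift t \<phi>) (\<phi> + shift t \<phi>)"
  proof -
    have c: "cis (- (pi / 4)) * (\<i> * z) * cis (- (pi / 4)) = z" for z
    proof -
      have "cis (- (pi / 4)) * (\<i> * z) * cis (- (pi / 4)) = (cis (- (pi / 4)) * cis (- (pi / 4))) * \<i> * z"
        by (simp only: ac_simps)
      also have "cis (- (pi / 4)) * cis (- (pi / 4)) = - \<i>"
        by (simp add: cis_mult)
      finally show ?thesis by simp
    qed
    have c': "cis (- (pi / 4)) * z * cis (pi / 4) = z" for z
    proof -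
      have "cis (- (pi / 4)) * z * cis (pi / 4) = (cis (- (pi / 4)) * cis (pi / 4)) * z"
        by (simp only: ac_simps)
      then show ?thesis by (simp add: cis_mult)
    qed
    have "qconj g0 (v_circle \<psi>) = (\<i> * cos \<psi>, sin \<psi>)" for \<psi>
      by (simp add: qconj_def g0_def v_circle c c' cis_cnj)
    moreover have "qconj e (v_circle \<psi>) = v_circle (\<psi> + shift t \<phi>)" for \<psi>
      unfolding e_def using qconj_e_v(1)[of "shift t \<phi> / 2" \<psi>] by simp
    ultimately have "qconj (g0 \<odot> e) (v_circle \<psi>) = (\<i> * cos (\<psi> + shift t \<phi>), sin (\<psi> + shift t \<phi>))" for \<psi>
      by (simp flip: qconj_qconj)
    then show ?thesis
      by (simp add: conj4_def circle_rep_words pillow_rep_circle algebra_simps)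
  qed
  ultimately show ?thesis
    by (metis torus_coords_conj4 torus_coords_normal_form qmult_in_SU2)
qed

lemma pillow_rep_0_half_pi: "pillow_rep 0 (pi / 2) = (qi, qi, qj, qj)"
  by (simp add: pillow_rep_circle) (simp add: qi_def qj_def)

lemma torus_coords_sphere2_circle_rep: "torus_coords (sphere2 t (circle_rep \<phi>)) = pillow (0, pi / 2)"
proof -
  \<comment> \<open>The rotation about j by 2u brings the first two entries back to i and leaves the
    last two entries, j, fixed.\<close>
  define u where "u = - (\<phi> + shift t \<phi>) / 2"
  define e where "e = (complex_of_real (cos u), - complex_of_real (sin u))"
  have "e \<in> SU2" unfolding e_def by (rule e_j_in_SU2)
  moreover have "conj4 e (sphere2 t (circle_rep \<phi>)) = pillow_rep 0 (pi / 2)"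
  proof -
    have "\<phi> + shift t \<phi> + 2 * u = 0" by (simp add: u_def field_simps)
    then have "qconj e (v_circle (\<phi> + shift t \<phi>)) = v_circle 0"
      unfolding e_def qconj_e_v(1) by simp
    moreover have "qconj e qj = qj" unfolding e_def by (rule qconj_e_v(2))
    ultimately show ?thesis
      by (simp add: pillow_rep_0_half_pi conj4_def circle_rep_words) (simp add: v_circle_def)
  qed
  ultimately show ?thesis
    by (metis torus_coords_conj4 torus_coords_normal_form)
qed

lemma torus_coords_sphere3_circle_rep: "torus_coords (sphere3 (circle_rep \<phi>)) = pillow (0, pi / 2)"
  using d_word_circle_rep[of \<phi>] torus_coords_normal_form[of 0 "pi / 2"]
  by (simp add: sphere3_def circle_rep_def pillow_rep_0_half_pi)

text \<open>The traces of \<open>x a\<close> and \<open>x a c\<close> are conjugation invariants that recover \<open>\<phi>\<close> modulo \<open>2 \<pi>\<close>.\<close>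

lemma conj_class_circle_rep_eq:
  assumes "conj_class (circle_rep \<phi>) = conj_class (circle_rep \<psi>)"
  shows "sin \<phi> = sin \<psi> \<and> cos \<phi> = cos \<psi>"
proof -
  have "circle_rep \<phi> \<in> conj_class (circle_rep \<psi>)"
    using conj_class_refl[of "circle_rep \<phi>"] assms by simp
  then obtain g where g: "g \<in> SU2" "circle_rep \<phi> = conj4 g (circle_rep \<psi>)"
    unfolding conj_class_def by blast
  then have eq: "qconj g qi = qi" "qconj g qj = qj" "v_circle \<phi> = qconj g (v_circle \<psi>)"
    by (simp_all add: circle_rep_def conj4_def)
  have "qRe (v_circle \<phi> \<odot> qi) = qRe (v_circle \<psi> \<odot> qi)"
    using qRe_qconj[OF g(1), of "v_circle \<psi> \<odot> qi"] eq by (simp add: qconj_qmult[OF g(1)])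
  moreover have "qRe (v_circle \<phi> \<odot> qi \<odot> qj) = qRe (v_circle \<psi> \<odot> qi \<odot> qj)"
    using qRe_qconj[OF g(1), of "v_circle \<psi> \<odot> qi \<odot> qj"] eq by (simp add: qconj_qmult[OF g(1)])
  ultimately show ?thesis
    by (simp add: v_circle qi_def qj_def)
qed

section \<open>Regularity and transversality\<close>

lemma bounded_bilinear_qmult: "bounded_bilinear (\<odot>)"
  unfolding bilinear_conv_bounded_bilinear[symmetric] bilinear_def
  by (intro conjI allI linearI) (simp_all add: qmult_add qmult_scaleR)

lemma differentiable_qmult:
  assumes "f differentiable (at x)" "h differentiable (at x)"
  shows "(\<lambda>x. f x \<odot> h x) differentiable (at x)"
  using assms bounded_bilinear.FDERIV[OF bounded_bilinear_qmult]
  unfolding differentiable_def by blast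

lemma bounded_linear_qcnj: "bounded_linear qcnj"
  and bounded_linear_qRe: "bounded_linear qRe"
  and bounded_linear_qIm: "bounded_linear qIm"
  unfolding linear_conv_bounded_linear[symmetric]
  by (intro linearI; simp add: qcnj_def qRe_def qIm_def prod_eq_iff algebra_simps)+

lemma differentiable_bounded_linear:
  assumes "bounded_linear L" "f differentiable (at x)"
  shows "(\<lambda>x. L (f x)) differentiable (at x)"
  using assms bounded_linear.has_derivative unfolding differentiable_def by blast

lemma differentiable_real_chain:
  fixes f :: "real \<Rightarrow> real" and h :: "'a::real_normed_vector \<Rightarrow> real"
  assumes "(f has_real_derivative f') (at (h x))" "h differentiable (at x)"
  shows "(\<lambda>x. f (h x)) differentiable (at x)"
  using assms has_derivative_compose[of h _ x UNIV f]
  unfolding differentiable_def has_field_derivative_def by blast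

text \<open>The formula for \<open>qexp\<close> divides by the norm of the imaginary part, and that
  norm is differentiable only away from 0; hence the nonvanishing hypothesis.\<close>

lemma differentiable_qexp:
  assumes f: "f differentiable (at x)" and nz: "qIm (f x) \<noteq> 0"
  shows "(\<lambda>x. qexp (f x)) differentiable (at x)"
proof -
  have im: "(\<lambda>x. qIm (f x)) differentiable (at x)"
    and re: "(\<lambda>x. qRe (f x)) differentiable (at x)"
    using f differentiable_bounded_linear bounded_linear_qIm bounded_linear_qRe by blast+
  have n: "(\<lambda>x. norm (qIm (f x))) differentiable (at x)"
    using differentiable_compose[OF differentiable_norm_at[OF nz] im] .
  have "(\<lambda>x. exp (qRe (f x))) differentiable (at x)"
    by (rule differentiable_real_chain[OF DERIV_exp re])
  moreover have "(\<lambda>x. cos (norm (qIm (f x)))) differentiable (at x)"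
    by (rule differentiable_real_chain[OF DERIV_cos n])
  moreover have "(\<lambda>x. sin (norm (qIm (f x)))) differentiable (at x)"
    by (rule differentiable_real_chain[OF DERIV_sin n])
  ultimately show ?thesis
    unfolding qexp_def using n nz im
    by (intro differentiable_scaleR differentiable_add differentiable_divide differentiable_const) auto
qed

text \<open>Restricting to a line on which \<open>f\<close> is affine reads off single values of the
  derivative without computing it as a whole.\<close>

lemma has_derivative_affine_line:
  assumes D: "(f has_derivative D) (at x)" and line: "\<And>s::real. f (x + s *\<^sub>R h) = f x + s *\<^sub>R k"
  shows "D h = k"
proof -
  have "((\<lambda>s::real. x + s *\<^sub>R h) has_derivative (\<lambda>s. s *\<^sub>R h)) (at 0)"
    by (auto intro!: derivative_eq_intros)
  then have "((\<lambda>s::real. f (x + s *\<^sub>R h)) has_derivative (\<lambda>s. D (s *\<^sub>R h))) (at 0)"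
    using has_derivative_compose[of "\<lambda>s::real. x + s *\<^sub>R h" _ 0 UNIV f D] D by simp
  moreover have "((\<lambda>s::real. f (x + s *\<^sub>R h)) has_derivative (\<lambda>s. s *\<^sub>R k)) (at 0)"
    unfolding line by (auto intro!: derivative_eq_intros)
  ultimately have "D (1 *\<^sub>R h) = 1 *\<^sub>R k"
    using has_derivative_unique by metis
  then show ?thesis by simp
qed

lemma differentiable_y_word_circle_rep:
  assumes "t * cos \<phi> \<noteq> 0"
  shows "(\<lambda>\<sigma>. (qRe (d_word \<sigma>), qRe (y_word t \<sigma>))) differentiable (at (circle_rep \<phi>))"
proof -
  define a b c x :: "rep_C3 \<Rightarrow> quat" where "a = fst" and "b = (\<lambda>\<sigma>. fst (snd \<sigma>))"
    and "c = (\<lambda>\<sigma>. fst (snd (snd \<sigma>)))" and "x = (\<lambda>\<sigma>. snd (snd (snd \<sigma>)))"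
  have lin: "bounded_linear a" "bounded_linear b" "bounded_linear c" "bounded_linear x"
    unfolding a_def b_def c_def x_def
    by (intro bounded_linear_fst bounded_linear_snd bounded_linear_fst_comp bounded_linear_snd_comp)+
  have diff: "a differentiable (at \<sigma>)" "b differentiable (at \<sigma>)" "c differentiable (at \<sigma>)" "x differentiable (at \<sigma>)" for \<sigma>
    using lin bounded_linear_imp_differentiable by blast+
  note cnj = differentiable_bounded_linear[OF bounded_linear_qcnj]
  define P where "P = (\<lambda>\<sigma>. qexp (t *\<^sub>R qIm (a \<sigma> \<odot> qcnj (c \<sigma>) \<odot> x \<sigma>)))"
  \<comment> \<open>On the circle the exponent of the perturbation element is -(t cos \<phi>) j, so
    the hypothesis keeps its imaginary part away from 0.\<close>
  have "qIm (t *\<^sub>R qIm (a (circle_rep \<phi>) \<odot> qcnj (c (circle_rep \<phi>)) \<odot> x (circle_rep \<phi>))) \<noteq> 0"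
    using assms by (simp add: a_def c_def x_def circle_rep_def qi_def qj_def v_circle zero_prod_def scaleR_conv_of_real)
  then have P: "P differentiable (at (circle_rep \<phi>))"
    unfolding P_def
    by (intro differentiable_qexp differentiable_scaleR differentiable_const
        differentiable_bounded_linear[OF bounded_linear_qIm] differentiable_qmult cnj diff)
  have "d_word \<sigma> = c \<sigma> \<odot> qcnj (a \<sigma>) \<odot> b \<sigma>"
    "y_word t \<sigma> = x \<sigma> \<odot> qcnj (P \<sigma>) \<odot> qcnj (a \<sigma>) \<odot> P \<sigma> \<odot> b \<sigma>" for \<sigma>
    by (cases \<sigma>; simp add: d_word_def y_word_def Let_def P_def a_def b_def c_def x_def pert_def)+
  then show ?thesis
    by (simp, intro differentiable_Pair differentiable_bounded_linear[OF bounded_linear_qRe]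
        differentiable_qmult cnj diff P)
qed

text \<open>
  The perturbation element does not involve \<open>b\<close>, so both equations are affine in \<open>b\<close>; the two
  tangent directions of the sphere of \<open>b\<close> already make the derivative surjective.
\<close>

lemma regular_circle_rep:
  assumes u: "t * cos \<phi> \<noteq> 0" and s: "sin (\<phi> + shift t \<phi>) \<noteq> 0"
  shows "regular_rep t (circle_rep \<phi>)"
proof -
  define f where "f = (\<lambda>\<sigma>. (qRe (d_word \<sigma>), qRe (y_word t \<sigma>)))"
  obtain D where D: "(f has_derivative D) (at (circle_rep \<phi>))"
    using differentiable_y_word_circle_rep[OF u] unfolding f_def differentiable_def by blast
  have b_line: "d_word (circle_rep \<phi> + r *\<^sub>R (0, b', 0, 0)) = qj + r *\<^sub>R (qj \<odot> qcnj qi \<odot> b')"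
    "y_word t (circle_rep \<phi> + r *\<^sub>R (0, b', 0, 0)) =
       y_word t (circle_rep \<phi>) + r *\<^sub>R (y_word t (circle_rep \<phi>) \<odot> qcnj qi \<odot> b')" for r b'
  proof -
    have i: "qi \<in> SU2" by (simp add: qi_def SU2_def norm_Pair)
    show "d_word (circle_rep \<phi> + r *\<^sub>R (0, b', 0, 0)) = qj + r *\<^sub>R (qj \<odot> qcnj qi \<odot> b')"
      using i by (simp add: circle_rep_def d_word_def qmult_add qmult_scaleR qmult_assoc)
    show "y_word t (circle_rep \<phi> + r *\<^sub>R (0, b', 0, 0)) =
       y_word t (circle_rep \<phi>) + r *\<^sub>R (y_word t (circle_rep \<phi>) \<odot> qcnj qi \<odot> b')"
      using i by (simp add: circle_rep_def y_word_def Let_def pert_def qmult_add qmult_scaleR qmult_assoc)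
  qed
  \<comment> \<open>In these directions the derivative is diagonal: moving b along j changes only
    the \<open>y_word\<close> equation, and moving it along k only the \<open>d_word\<close>
    equation. The hypothesis on the sine makes the first diagonal entry invertible.\<close>
  have Dj: "D (0, qj, 0, 0) = (0, sin (\<phi> + shift t \<phi>))"
    unfolding f_def
    by (rule has_derivative_affine_line[OF D[unfolded f_def]], unfold b_line)
      (simp add: d_word_circle_rep circle_rep_words v_circle qi_def qj_def)
  have Dk: "D (0, qk, 0, 0) = (-1, 0)"
    unfolding f_def
    by (rule has_derivative_affine_line[OF D[unfolded f_def]], unfold b_line)
      (simp add: d_word_circle_rep circle_rep_words v_circle qi_def qj_def qk_def)
  have "D ` spheres_tangent (circle_rep \<phi>) = UNIV"
  proof (rule UNIV_eq_I[symmetric])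
    fix p :: "real \<times> real"
    let ?h = "(snd p / sin (\<phi> + shift t \<phi>)) *\<^sub>R (0, qj, 0, 0) + (- fst p) *\<^sub>R (0, qk, 0, 0)"
    have "D ?h = p"
      using s by (simp only: has_derivative_linear[OF D, THEN linear_add]
          has_derivative_linear[OF D, THEN linear_scale] Dj Dk) (simp add: prod_eq_iff)
    moreover have "?h \<in> spheres_tangent (circle_rep \<phi>)"
      by (simp add: spheres_tangent_def circle_rep_def qi_def qj_def qk_def)
        (simp add: qRe_def inner_complex_def)
    ultimately show "p \<in> D ` spheres_tangent (circle_rep \<phi>)" by (metis imageI)
  qed
  with D circle_rep_in_rep_space show ?thesis
    unfolding regular_rep_def f_def by blast
qed

section \<open>Velocities along the rational line and along the circle\<close>

lemma A_velocities_line: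
  assumes "3 * \<theta> - \<gamma> = 2 * pi * of_int n"
  shows "(3 * r, r) \<in> A_velocities (\<gamma>, \<theta>)"
proof -
  \<comment> \<open>The direction (3, 1) keeps 3\<theta> - \<gamma> constant, so the whole straight
    path lifts the rational line.\<close>
  define h where "h = (\<lambda>s. (\<gamma> + 3 * r * s, \<theta> + r * s))"
  have "pillow (h s) \<in> A_third" for s
    using assms unfolding A_third_def h_def by (intro imageI) (auto simp: algebra_simps intro!: exI[of _ n])
  moreover have "(h has_vector_derivative (3 * r, r)) (at 0)"
    unfolding h_def by (auto intro!: derivative_eq_intros has_vector_derivative_Pair)
  moreover have "h 0 = (\<gamma>, \<theta>)" by (simp add: h_def)
  ultimately show ?thesis
    unfolding A_velocities_def by (intro CollectI exI[of _ h]) simp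
qed

text \<open>The circle itself is traversed at speed \<open>r\<close>; its first boundary value lifts
  to (2t cos \<phi>, \<phi> + 2t cos \<phi>), which is differentiated in \<phi>.\<close>

lemma p1_velocities_circle:
  "(r * (- 2 * t * sin \<phi>), r * (1 - 2 * t * sin \<phi>)) \<in> p1_velocities t (circle_rep \<phi>) (shift t \<phi>, \<phi> + shift t \<phi>)"
proof -
  define \<kappa> where "\<kappa> = (\<lambda>s. circle_rep (\<phi> + r * s))"
  define h where "h = (\<lambda>s. (shift t (\<phi> + r * s), (\<phi> + r * s) + shift t (\<phi> + r * s)))"
  have "(\<kappa> has_vector_derivative (0, 0, 0, r *\<^sub>R (- sin \<phi> *\<^sub>R qi + cos \<phi> *\<^sub>R qk))) (at 0)"
    unfolding \<kappa>_def circle_rep_def v_circle_def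
    by (auto intro!: derivative_eq_intros has_vector_derivative_Pair simp: algebra_simps)
  then have "\<kappa> differentiable (at 0)"
    by (auto simp: has_vector_derivative_def differentiable_def)
  moreover have "(h has_vector_derivative (r * (- 2 * t * sin \<phi>), r * (1 - 2 * t * sin \<phi>))) (at 0)"
    unfolding h_def shift_def
    by (auto intro!: derivative_eq_intros has_vector_derivative_Pair simp: algebra_simps
        simp flip: has_real_derivative_iff_has_vector_derivative)
  moreover have "\<kappa> s \<in> rep_space t" "torus_coords (sphere1 t (\<kappa> s)) = pillow (h s)" for s
    by (simp_all add: \<kappa>_def h_def circle_rep_in_rep_space torus_coords_sphere1_circle_rep)
  moreover have "\<kappa> 0 = circle_rep \<phi>" "h 0 = (shift t \<phi>, \<phi> + shift t \<phi>)"
    by (simp_all add: \<kappa>_def h_def)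
  ultimately show ?thesis
    unfolding p1_velocities_def by (intro CollectI exI[of _ \<kappa>] exI[of _ h]) simp
qed

text \<open>The first entry is the value of \<open>p1\<close> on the class, as the fiber product
  demands; the condition of lying on \<open>A_third\<close> is left to a separate equation on
  \<phi>.\<close>

definition circle_point :: "real \<Rightarrow> real \<Rightarrow> pillow_point \<times> rep_C3 set" where
  "circle_point t \<phi> = (pillow (shift t \<phi>, \<phi> + shift t \<phi>), conj_class (circle_rep \<phi>))"

text \<open>With u = t cos \<phi>, the line equation 3(\<phi> + 2u) - 2u is 3\<phi> + 4u. The sine
  hypothesis keeps \<open>p1\<close> off the corners, while \<open>p2\<close> and \<open>p3\<close>
  sit at the smooth point (0, \<pi>/2).\<close>

lemma circle_point_in_F_third:
  assumes "sin (shift t \<phi>) \<noteq> 0" and "3 * \<phi> + 4 * t * cos \<phi> = 2 * pi * of_int n"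
  shows "circle_point t \<phi> \<in> F_third t"
proof -
  have "3 * (\<phi> + shift t \<phi>) - shift t \<phi> = 2 * pi * of_int n"
    using assms(2) by (simp add: shift_def algebra_simps)
  then have "pillow (shift t \<phi>, \<phi> + shift t \<phi>) \<in> A_third"
    unfolding A_third_def by blast
  moreover have "pillow (shift t \<phi>, \<phi> + shift t \<phi>) \<in> pillow_smooth" "pillow (0, pi / 2) \<in> pillow_smooth"
    using assms(1) by (simp_all add: pillow_smoothI)
  ultimately show ?thesis
    by (simp add: circle_point_def F_third_def C3_reg_def char_var_def circle_rep_in_rep_space
        restriction_conj_class torus_coords_sphere1_circle_rep torus_coords_sphere2_circle_rep
        torus_coords_sphere3_circle_rep)
qed

lemma F_map_circle_point: "F_map t (circle_point t \<phi>) = (pillow (0, pi / 2), pillow (0, pi / 2))"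
  by (simp add: circle_point_def F_map_def restriction_conj_class
      torus_coords_sphere2_circle_rep torus_coords_sphere3_circle_rep)

lemma transverse_circle_point:
  assumes u: "sin (shift t \<phi>) \<noteq> 0" and n: "3 * \<phi> + 4 * t * cos \<phi> = 2 * pi * of_int n"
    and t: "4 * t * sin \<phi> \<noteq> 3"
  shows "transverse_at t (circle_point t \<phi>)"
proof -
  define w where "w = (shift t \<phi>, \<phi> + shift t \<phi>)"
  have n': "3 * (\<phi> + shift t \<phi>) - shift t \<phi> = 2 * pi * of_int n"
    using n by (simp add: shift_def algebra_simps)
  \<comment> \<open>On the line of slope 1/3, if the second coordinate is a multiple of \<pi> then
    so is the first, contradicting \<open>u\<close>. This supplies the second condition for
    regularity.\<close>
  have "sin (\<phi> + shift t \<phi>) \<noteq> 0"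
  proof
    assume "sin (\<phi> + shift t \<phi>) = 0"
    then obtain i :: int where "\<phi> + shift t \<phi> = of_int i * pi"
      by (auto simp: sin_zero_iff_int2)
    with n' have "shift t \<phi> = of_int (3 * i - 2 * n) * pi"
      by (simp add: algebra_simps)
    with u show False by (metis sin_zero_iff_int2)
  qed
  moreover have "t * cos \<phi> \<noteq> 0" using u by (auto simp: shift_def)
  ultimately have "regular_rep t (circle_rep \<phi>)" by (intro regular_circle_rep)
  moreover have "{p + v | p v. p \<in> A_velocities w \<and> v \<in> p1_velocities t (circle_rep \<phi>) w} = UNIV"
  proof (rule UNIV_eq_I[symmetric])
    fix q :: "real \<times> real"
    \<comment> \<open>Cramer's rule for writing \<open>q\<close> as r' (3, 1) plus r times the
      circle velocity; \<open>E\<close> is the determinant up to sign.\<close>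
    define E where "E = 3 - 4 * t * sin \<phi>"
    define r where "r = (3 * snd q - fst q) / E"
    define r' where "r' = (fst q + 2 * t * sin \<phi> * r) / 3"
    have E: "E \<noteq> 0" using t by (simp add: E_def)
    have "3 * r - 4 * (t * sin \<phi> * r) = 3 * snd q - fst q"
    proof -
      have "3 * r - 4 * (t * sin \<phi> * r) = r * E" by (simp add: E_def algebra_simps)
      with E show ?thesis by (simp add: r_def)
    qed
    moreover have "3 * r' = fst q + 2 * (t * sin \<phi> * r)"
      by (simp add: r'_def)
    ultimately have "snd q = r' + (r - 2 * (t * sin \<phi> * r))" "fst q = 3 * r' - 2 * (t * sin \<phi> * r)"
      by linarith+
    then have "q = (3 * r', r') + (r * (- 2 * t * sin \<phi>), r * (1 - 2 * t * sin \<phi>))"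
      by (simp add: prod_eq_iff algebra_simps)
    moreover have "(3 * r', r') \<in> A_velocities w"
      unfolding w_def using n' by (rule A_velocities_line)
    moreover note p1_velocities_circle[of r t \<phi>, folded w_def]
    ultimately show "q \<in> {p + v | p v. p \<in> A_velocities w \<and> v \<in> p1_velocities t (circle_rep \<phi>) w}"
      by blast
  qed
  ultimately show ?thesis
    unfolding transverse_at_def circle_point_def prod.case
    by (intro bexI[OF _ conj_class_refl] exI[of _ w] conjI) (simp_all only: w_def)
qed

section \<open>The three solutions\<close>

text \<open>A subspace retains only points of the ambient space, so \<open>F_third\<close> must be
  seen to lie in the product of the two quotients. This lets injectivity of an embedding be stated
  on \<open>F_third\<close>.\<close>

lemma topspace_F_top: "topspace (F_top t) = F_third t"
proof -
  have "topspace pillow_top = range pillow" "topspace (char_var_top t) = char_var t"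
    using quotient_map_quotient_top[of euclidean pillow]
      quotient_map_quotient_top[of "top_of_set (rep_space t)" conj_class]
    by (auto dest!: quotient_imp_surjective_map simp: pillow_top_def char_var_top_def char_var_def)
  then show ?thesis
    by (auto simp: F_top_def F_third_def A_third_def C3_reg_def)
qed

text \<open>Moving \<phi> by 4t/3 changes 3\<phi> by 4t, which absorbs the bounded term 4t cos
  \<phi>; the intermediate value theorem on the interval of that radius gives a root.\<close>

lemma perturbed_equation_solution:
  fixes t :: real
  assumes "t \<ge> 0"
  shows "\<exists>\<phi>. \<bar>\<phi> - 2 * pi * c / 3\<bar> \<le> 4 * t / 3 \<and> 3 * \<phi> + 4 * t * cos \<phi> = 2 * pi * c"
proof -
  define f m e where "f = (\<lambda>\<phi>. 3 * \<phi> + 4 * t * cos \<phi>)" and "m = 2 * pi * c / 3" and "e = 4 * t / 3"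
  have m: "3 * m = 2 * pi * c" and e: "3 * e = 4 * t" by (simp_all add: m_def e_def)
  have b: "\<bar>4 * t * cos \<psi>\<bar> \<le> 3 * e" for \<psi>
    using assms abs_cos_le_one[of \<psi>] by (simp add: e abs_mult mult_left_le)
  have f: "f (m - e) = 3 * m - 3 * e + 4 * t * cos (m - e)"
    "f (m + e) = 3 * m + 3 * e + 4 * t * cos (m + e)"
    by (simp_all add: f_def)
  have "f (m - e) \<le> 2 * pi * c"
    using f(1) b[of "m - e", THEN abs_le_D1] m by linarith
  moreover have "2 * pi * c \<le> f (m + e)"
    using f(2) b[of "m + e", THEN abs_le_D2] m by linarith
  moreover have "continuous_on A f" for A
    unfolding f_def by (intro continuous_intros)
  moreover have "m - e \<le> m + e" using assms by (simp add: e_def)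
  ultimately obtain \<phi> where "m - e \<le> \<phi>" "\<phi> \<le> m + e" "f \<phi> = 2 * pi * c"
    using IVT'[of f "m - e" "2 * pi * c" "m + e"] by blast
  then have "\<bar>\<phi> - m\<bar> \<le> e \<and> 3 * \<phi> + 4 * t * cos \<phi> = 2 * pi * c"
    by (simp add: f_def abs_le_iff)
  then show ?thesis unfolding m_def e_def by blast
qed

lemma three_circle_points:
  fixes t :: real
  assumes t: "0 < t" "t < 1/4"
  shows "\<exists>\<Phi>. card \<Phi> = 3 \<and> inj_on (circle_point t) \<Phi> \<and>
    (\<forall>\<phi>\<in>\<Phi>. sin (shift t \<phi>) \<noteq> 0 \<and> (\<exists>n::int. 3 * \<phi> + 4 * t * cos \<phi> = 2 * pi * of_int n))"
proof -
  have "\<forall>n::nat. \<exists>\<phi>. \<bar>\<phi> - 2 * pi * real n / 3\<bar> \<le> 4 * t / 3 \<and> 3 * \<phi> + 4 * t * cos \<phi> = 2 * pi * real n"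
    using t by (intro allI perturbed_equation_solution) simp
  then obtain F where F: "\<And>n::nat. \<bar>F n - 2 * pi * real n / 3\<bar> \<le> 4 * t / 3"
    "\<And>n. 3 * F n + 4 * t * cos (F n) = 2 * pi * real n"
    by metis
  \<comment> \<open>Radius \<pi>/6 keeps the intervals around 0, 2\<pi>/3 and 4\<pi>/3 disjoint and
    free of zeros of the cosine: \<pi>/2 and 3\<pi>/2 lie exactly \<pi>/6 from the last two
    centers.\<close>
  have small: "4 * t / 3 < pi / 6" using t pi_gt3 by simp
  have F0: "- (pi / 6) < F 0" "F 0 < pi / 6" and F1: "pi / 2 < F 1" "F 1 < 5 * pi / 6"
    and F2: "7 * pi / 6 < F 2" "F 2 < 3 * pi / 2"
    using F(1)[of 0] F(1)[of 1] F(1)[of 2] small by (simp_all add: abs_le_iff field_simps)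
  have cos_neg: "cos \<psi> \<noteq> 0" if "pi / 2 < \<psi>" "\<psi> < 3 * pi / 2" for \<psi>
    using cos_gt_zero_pi[of "\<psi> - pi"] that by (simp add: cos_diff)
  have "cos (F n) \<noteq> 0" if "n \<in> {0, 1, 2}" for n
    using that F0 F1 F2 pi_gt_zero cos_gt_zero_pi[of "F 0"] cos_neg[of "F 1"] cos_neg[of "F 2"]
    by (auto simp: field_simps)
  moreover have "sin (shift t \<phi>) \<noteq> 0" if "cos \<phi> \<noteq> 0" for \<phi>
  proof -
    \<comment> \<open>A nonzero shift of size below \<pi> cannot be a multiple of \<pi>.\<close>
    have "\<bar>shift t \<phi>\<bar> \<le> 2 * t"
      using t abs_cos_le_one[of \<phi>] by (simp add: shift_def abs_mult)
    then have "\<bar>shift t \<phi>\<bar> < pi" "shift t \<phi> \<noteq> 0"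
      using t pi_gt3 that by (auto simp: shift_def)
    then show ?thesis
      using sin_gt_zero[of "shift t \<phi>"] sin_gt_zero[of "- shift t \<phi>"] by (cases "shift t \<phi> > 0") auto
  qed
  ultimately have "\<forall>\<phi>\<in>F ` {0, 1, 2}. sin (shift t \<phi>) \<noteq> 0 \<and> (\<exists>n::int. 3 * \<phi> + 4 * t * cos \<phi> = 2 * pi * of_int n)"
    using F(2) by (metis imageE of_int_of_nat_eq)
  moreover have "card (F ` {0, 1, 2}) = 3"
    using F0 F1 F2 pi_gt_zero by auto
  moreover have "inj_on (circle_point t) (F ` {0, 1, 2})"
  proof (rule inj_onI)
    fix \<phi> \<psi> assume "\<phi> \<in> F ` {0, 1, 2}" "\<psi> \<in> F ` {0, 1, 2}" and eq: "circle_point t \<phi> = circle_point t \<psi>"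
    \<comment> \<open>All three angles lie between -\<pi>/6 and 3\<pi>/2, so knowing an angle modulo
      2\<pi>, which the conjugacy class provides, determines it.\<close>
    then have lt: "\<bar>\<phi> - \<psi>\<bar> < 2 * pi" using F0 F1 F2 by auto
    have "sin \<phi> = sin \<psi> \<and> cos \<phi> = cos \<psi>"
      using eq by (intro conj_class_circle_rep_eq) (simp add: circle_point_def)
    then obtain m :: int where m: "\<phi> = \<psi> + 2 * pi * of_int m"
      unfolding sin_cos_eq_iff by blast
    with lt have "\<bar>real_of_int m\<bar> < 1" by (simp add: abs_mult)
    then show "\<phi> = \<psi>" using m by simp
  qed
  ultimately show ?thesis by blast
qed

section \<open>The triple point and the loss of injectivity for small t\<close>

theorem proposition3p3:
  shows "\<forall>\<^sub>F t in at_right (0::real).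
    (\<exists>S \<subseteq> F_third t. card S = 3 \<and>
       (\<forall>f \<in> S. transverse_at t f \<and> F_map t f = (pillow (0, pi / 2), pillow (0, pi / 2)))) \<and>
    \<not> F_embedded t"
proof -
  have main: "(\<exists>S \<subseteq> F_third t. card S = 3 \<and>
       (\<forall>f \<in> S. transverse_at t f \<and> F_map t f = (pillow (0, pi / 2), pillow (0, pi / 2)))) \<and>
    \<not> F_embedded t" if t: "0 < t" "t < 1/4" for t :: real
  proof -
    obtain \<Phi> where \<Phi>: "card \<Phi> = 3" "inj_on (circle_point t) \<Phi>"
      "\<And>\<phi>. \<phi> \<in> \<Phi> \<Longrightarrow> sin (shift t \<phi>) \<noteq> 0"
      "\<And>\<phi>. \<phi> \<in> \<Phi> \<Longrightarrow> \<exists>n::int. 3 * \<phi> + 4 * t * cos \<phi> = 2 * pi * of_int n"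
      using three_circle_points[OF t] by blast
    define S where "S = circle_point t ` \<Phi>"
    \<comment> \<open>The bound t < 1/4 gives 4t sin \<phi> < 1, so the determinant 4t sin \<phi> -
      3 cannot vanish.\<close>
    have tr: "4 * t * sin \<phi> \<noteq> 3" for \<phi>
    proof -
      have "4 * t * sin \<phi> \<le> 4 * t" using t by (simp add: mult_left_le)
      with t show ?thesis by linarith
    qed
    have "circle_point t \<phi> \<in> F_third t \<and> transverse_at t (circle_point t \<phi>)" if "\<phi> \<in> \<Phi>" for \<phi>
      using \<Phi>(3,4)[OF that] circle_point_in_F_third transverse_circle_point[OF _ _ tr] by blast
    then have S: "S \<subseteq> F_third t" "card S = 3"
      "\<forall>f \<in> S. transverse_at t f \<and> F_map t f = (pillow (0, pi / 2), pillow (0, pi / 2))"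
      unfolding S_def using \<Phi>(1,2) by (blast, metis card_image, simp add: F_map_circle_point)
    have "\<not> F_embedded t"
    proof
      assume "F_embedded t"
      \<comment> \<open>A homeomorphism onto the image is injective, whereas \<open>F_map\<close>
        collapses the three points of \<open>S\<close> to one.\<close>
      then have "inj_on (F_map t) (F_third t)"
        unfolding F_embedded_def embedding_map_def
        using homeomorphic_imp_injective_map topspace_F_top by fastforce
      then have "inj_on (F_map t) S" using S(1) inj_on_subset by blast
      then have "card S = card (F_map t ` S)" by (simp add: card_image)
      also have "\<dots> \<le> card {(pillow (0, pi / 2), pillow (0, pi / 2))}"
        using S(3) by (intro card_mono) auto
      finally have "card S \<le> 1" by simp
      with S(2) show False by simp
    qed
    with S show ?thesis by blast
  qed
  show ?thesis
    unfolding eventually_at_right_field using main by (intro exI[of _ "1/4"]) auto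
qed

end
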